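(* Let $m\ge2$ be an integer, let $\mu\ne0$ be a real constant, let $I\subset(0,\infty)$ be an open interval and let $u:I\to\mathbb R$ be a smooth function with $u'(\alpha)\neq0$ for all $\alpha\in I$. The rotational surface in $(\mathbb R^3,\|\cdot\|)$ given by $$\bar X(\alpha,v)=(\alpha\cos v,\ \alpha\sin v,\ u(\alpha)),\qquad \alpha\in I,$$ satisfies $k_1-k_2=\mu$ (at every point) if and only if $$u(\alpha)=\pm\int\frac{\alpha^{2m-1}(c_1-\mu\log\alpha)^{2m-1}}{\left\{1-\alpha^{2m}(c_1-\mu\log\alpha)^{2m}\right\}^{\frac{2m-1}{2m}}}\,d\alpha$$ for some real constant $c_1$, where one needs $$c_1-\mu\log\alpha>0,\qquad \alpha(c_1-\mu\log\alpha)<1\qquad\text{for all }\alpha\in I;$$ that is, if and only if there are $c_1\in\mathbb R$ satisfying these two inequalities on $I$ and a sign (constant on $I$) such that $u$ is an antiderivative on $I$ of $\pm$ the displayed integrand.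
   Context: The norm on $\mathbb R^3$ is $\|x\|=\left((x_1^2+x_2^2)^m+x_3^{2m}\right)^{1/(2m)}$, with $m\ge2$ an integer. Put $\Phi(x)=(x_1^2+x_2^2)^m+x_3^{2m}$; the unit sphere is $S=\{\Phi=1\}$. For an immersed surface $M$ in $(\mathbb R^3,\|\cdot\|)$, a Birkhoff-Gauss map is a local map $\eta:M\to S$ such that, for each $p$, the tangent plane of $S$ at $\eta(p)$ is parallel to $T_pM$ (it is determined up to sign); the principal curvatures are the eigenvalues of $d\eta_p$. Choice of sign and labelling: the surface $\bar X$ with $u'\ne0$ is regarded as reparametrized by height, $X(u,v)=(\alpha(u)\cos v,\alpha(u)\sin v,u)$, where $\alpha(u)>0$ is the inverse function of $u(\alpha)$, so that $\alpha'\neq0$. The map $\eta$ is fixed by $(\operatorname{grad}\Phi)_\eta=\varphi\,X_u\times X_v$ with $\varphi>0$ ($\times$ the standard cross product), and $k_1,k_2$ are the principal curvatures in the profile and rotation directions: $\eta_u=k_1X_u$, $\eta_v=k_2X_v$. Explicitly (with primes denoting $d/du$, odd roots of negative numbers being the real ones), $$k_1=\frac1{2m-1}\left((\alpha')^{\frac{2m}{2m-1}}+1\right)^{-\frac{2m+1}{2m}}(\alpha')^{-\frac{2m-2}{2m-1}}\alpha'',\qquad k_2=-\frac1\alpha\left((\alpha')^{\frac{2m}{2m-1}}+1\right)^{-\frac1{2m}}.$$ *)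

theory Defs
  imports "HOL-Analysis.Analysis"
begin

unbundle cross3_syntax

definition Phi :: "nat \<Rightarrow> real^3 \<Rightarrow> real" where
  "Phi m x = ((x$1)\<^sup>2 + (x$2)\<^sup>2) ^ m + (x$3) ^ (2*m)"

definition mnorm :: "nat \<Rightarrow> real^3 \<Rightarrow> real" where
  "mnorm m x = root (2*m) (Phi m x)"

definition msphere :: "nat \<Rightarrow> (real^3) set" where
  "msphere m = {x. mnorm m x = 1}"

lemma msphere_eq: "m \<ge> 2 \<Longrightarrow> msphere m = {x. Phi m x = 1}"
  by (auto simp: msphere_def mnorm_def)

text \<open>The (linear) tangent plane of the regular level set \<open>msphere m\<close> at one of its points.\<close>

definition msphere_tangent :: "nat \<Rightarrow> real^3 \<Rightarrow> (real^3) set" where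
  "msphere_tangent m q = {w. frechet_derivative (Phi m) (at q) w = 0}"

definition partial_u :: "(real \<Rightarrow> real \<Rightarrow> real^3) \<Rightarrow> real \<Rightarrow> real \<Rightarrow> real^3" where
  "partial_u X u v = vector_derivative (\<lambda>s. X s v) (at u)"

definition partial_v :: "(real \<Rightarrow> real \<Rightarrow> real^3) \<Rightarrow> real \<Rightarrow> real \<Rightarrow> real^3" where
  "partial_v X u v = vector_derivative (\<lambda>t. X u t) (at v)"

text \<open>
  The Birkhoff-Gauss map of a parametrized surface \<open>X\<close>, as a function of the parameters: the point
  of the unit sphere whose tangent plane is parallel to the one of the surface, the two candidates
  being distinguished by the requirement that the gradient of \<open>Phi m\<close> there is a positive multiple
  of \<open>X\<^sub>u \<times> X\<^sub>v\<close>.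
\<close>

definition is_birkhoff_gauss_at ::
    "nat \<Rightarrow> (real \<Rightarrow> real \<Rightarrow> real^3) \<Rightarrow> real \<Rightarrow> real \<Rightarrow> real^3 \<Rightarrow> bool" where
  "is_birkhoff_gauss_at m X u v q \<longleftrightarrow>
     q \<in> msphere m \<and>
     msphere_tangent m q = span {partial_u X u v, partial_v X u v} \<and>
     (\<exists>\<phi>>0. GDERIV (Phi m) q :> \<phi> *\<^sub>R (partial_u X u v \<times> partial_v X u v))"

definition birkhoff_gauss :: "nat \<Rightarrow> (real \<Rightarrow> real \<Rightarrow> real^3) \<Rightarrow> real \<Rightarrow> real \<Rightarrow> real^3" where
  "birkhoff_gauss m X u v = (THE q. is_birkhoff_gauss_at m X u v q)"

text \<open>
  The differential of the Birkhoff-Gauss map sends \<open>X\<^sub>u\<close> to \<open>\<eta>\<^sub>u\<close> and \<open>X\<^sub>v\<close> to \<open>\<eta>\<^sub>v\<close>; for a surface of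
  revolution these are eigendirections, and \<open>k1\<close>, \<open>k2\<close> are the eigenvalues belonging to the profile
  direction \<open>X\<^sub>u\<close> and the rotation direction \<open>X\<^sub>v\<close>.
\<close>

definition k1 :: "nat \<Rightarrow> (real \<Rightarrow> real \<Rightarrow> real^3) \<Rightarrow> real \<Rightarrow> real \<Rightarrow> real" where
  "k1 m X u v =
     (THE k. ((\<lambda>s. birkhoff_gauss m X s v) has_vector_derivative k *\<^sub>R partial_u X u v) (at u))"

definition k2 :: "nat \<Rightarrow> (real \<Rightarrow> real \<Rightarrow> real^3) \<Rightarrow> real \<Rightarrow> real \<Rightarrow> real" where
  "k2 m X u v =
     (THE k. ((\<lambda>t. birkhoff_gauss m X u t) has_vector_derivative k *\<^sub>R partial_v X u v) (at v))"

definition rot_surface :: "(real \<Rightarrow> real) \<Rightarrow> real \<Rightarrow> real \<Rightarrow> real^3" where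
  "rot_surface u \<alpha> v = vector [\<alpha> * cos v, \<alpha> * sin v, u \<alpha>]"

text \<open>The same surface with the height \<open>h = u \<alpha>\<close> as first parameter.\<close>

definition rot_surface_by_height :: "real set \<Rightarrow> (real \<Rightarrow> real) \<Rightarrow> real \<Rightarrow> real \<Rightarrow> real^3" where
  "rot_surface_by_height I u h v = rot_surface u (inv_into I u h) v"

lemma rot_surface_by_height_eq:
  assumes "h \<in> u ` I"
  shows "rot_surface_by_height I u h v =
    vector [inv_into I u h * cos v, inv_into I u h * sin v, h]"
  using assms by (simp add: rot_surface_by_height_def rot_surface_def f_inv_into_f)

text \<open>Only used for open \<open>I\<close>, where the iterated two-sided derivatives are the right notion.\<close>

definition smooth_on_open :: "real set \<Rightarrow> (real \<Rightarrow> real) \<Rightarrow> bool" where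
  "smooth_on_open I f \<longleftrightarrow> (\<forall>n. \<forall>x\<in>I. (deriv ^^ n) f differentiable (at x))"

definition profile_integrand :: "nat \<Rightarrow> real \<Rightarrow> real \<Rightarrow> real \<Rightarrow> real" where
  "profile_integrand m \<mu> c\<^sub>1 \<alpha> =
     \<alpha> ^ (2*m - 1) * (c\<^sub>1 - \<mu> * ln \<alpha>) ^ (2*m - 1) /
     (1 - \<alpha> ^ (2*m) * (c\<^sub>1 - \<mu> * ln \<alpha>) ^ (2*m)) powr (real (2*m - 1) / real (2*m))"

end

theory Submission
  imports Defs
begin

text \<open>
  Write \<open>d = u' x\<close> for the slope of the profile at radius \<open>x\<close>. The Birkhoff-Gauss map is itself
  rotational, \<open>\<eta> = (- P cos v, - P sin v, Q)\<close>, where \<open>(P, Q)\<close> is the point of the curve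
  \<open>P ^ (2*m) + Q ^ (2*m) = 1\<close> with \<open>P > 0\<close> and \<open>(Q / P) ^ (2*m - 1) = 1 / d\<close>. With the radius \<open>x\<close> as
  parameter instead of the height, the principal curvatures become \<open>k1 = - P'\<close> and \<open>k2 = - P / x\<close>,
  so the curvature condition is the linear equation \<open>P / x - P' = \<mu>\<close>, with the solutions
  \<open>P = x * (c - \<mu> * ln x)\<close>. Since \<open>P\<close> determines \<open>d\<close> up to sign, this is the claimed integral
  formula; the sign is constant because \<open>u'\<close> is continuous without zeros.
\<close>

section \<open>The curve P^(2m) + Q^(2m) = 1 and its point with prescribed normal direction\<close>

declare One_nat_def [simp del]

text \<open>This is the quotient Q / P. The odd real root keeps the sign of \<open>d\<close>, so
  \<open>Q\<close> has the sign of the slope while \<open>P\<close> stays positive.\<close>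

definition normal_slope :: "nat \<Rightarrow> real \<Rightarrow> real" where
  "normal_slope m d = root (2*m - 1) (1 / d)"

definition normal_radius :: "nat \<Rightarrow> real \<Rightarrow> real" where
  "normal_radius m d = 1 / root (2*m) (1 + normal_slope m d ^ (2*m))"

definition normal_height :: "nat \<Rightarrow> real \<Rightarrow> real" where
  "normal_height m d = normal_slope m d * normal_radius m d"

lemma odd_pred_double: "m \<ge> 2 \<Longrightarrow> odd (2*m - 1 :: nat)"
  by auto

text \<open>Splits the exponent as it occurs in the gradient of \<open>Phi m\<close>, where the
  squared distance from the axis carries the power m - 1.\<close>

lemma power_double_pred:
  fixes x :: "'a::comm_monoid_mult"
  assumes "m \<ge> 2"
  shows "x ^ (2*m - 1) = x * (x\<^sup>2) ^ (m - 1)"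
proof -
  obtain k where "m = Suc k" using assms by (cases m) auto
  then show ?thesis by (simp add: power_mult)
qed

lemma normal_slope_power: "m \<ge> 2 \<Longrightarrow> normal_slope m d ^ (2*m - 1) = 1 / d"
  unfolding normal_slope_def by (rule odd_real_root_pow) (rule odd_pred_double)

lemma normal_radius_pos: "m \<ge> 2 \<Longrightarrow> normal_radius m d > 0"
  by (simp add: normal_radius_def add_pos_nonneg zero_le_even_power)

lemma normal_radius_power:
  "m \<ge> 2 \<Longrightarrow> normal_radius m d ^ (2*m) * (1 + normal_slope m d ^ (2*m)) = 1"
proof -
  assume m: "m \<ge> 2"
  have "1 + normal_slope m d ^ (2*m) > 0" by (simp add: add_pos_nonneg zero_le_even_power)
  then show ?thesis
    using m by (simp add: normal_radius_def power_divide del: power_mult)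
qed

text \<open>The gradient of P^(2m) + Q^(2m) has direction (P^(2m-1), Q^(2m-1)); this makes it
  parallel to (1, 1/d), the normal direction of the profile.\<close>

lemma normal_height_power: "m \<ge> 2 \<Longrightarrow> normal_height m d ^ (2*m - 1) = normal_radius m d ^ (2*m - 1) / d"
  by (simp add: normal_height_def power_mult_distrib normal_slope_power)

lemma normal_on_curve: "m \<ge> 2 \<Longrightarrow> normal_radius m d ^ (2*m) + normal_height m d ^ (2*m) = 1"
  using normal_radius_power[of m d] by (simp add: normal_height_def power_mult_distrib algebra_simps)

text \<open>For a nonzero slope Q does not vanish, so Q^(2m) takes a positive share of the sum 1.
  The second inequality on \<open>c\<^sub>1\<close> comes from here.\<close>

lemma normal_radius_less_1:
  assumes "m \<ge> 2" "d \<noteq> 0"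
  shows "normal_radius m d < 1"
proof (rule ccontr)
  assume "\<not> ?thesis"
  then have "normal_radius m d ^ (2*m) \<ge> 1" by simp
  moreover have "normal_height m d ^ (2*m) > 0"
    using normal_radius_pos[of m d] assms by (simp add: normal_height_def normal_slope_def zero_less_power_eq)
  ultimately show False using normal_on_curve[of m d] assms by linarith
qed

lemma normal_radius_unique:
  assumes "m \<ge> 2" "p > 0" "p ^ (2*m) * (1 + normal_slope m d ^ (2*m)) = 1"
  shows "p = normal_radius m d"
proof -
  have "1 + normal_slope m d ^ (2*m) > 0" by (simp add: add_pos_nonneg zero_le_even_power)
  then have "p ^ (2*m) = normal_radius m d ^ (2*m)"
    using assms normal_radius_power[of m d] by (metis mult_right_cancel less_numeral_extra(3))
  then show ?thesis
    using assms normal_radius_pos[of m d] power_eq_imp_eq_base[of p "2*m" "normal_radius m d"]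
    by linarith
qed

text \<open>Inverts the passage from slope to radius: the curve equation gives p |t| as the 2m-th
  root of 1 - p^(2m), and |t|^(2m-1) = 1/|d|. Only the modulus of \<open>d\<close> can be recovered,
  because \<open>t\<close> enters through an even power.\<close>

lemma normal_radius_eq_iff:
  assumes m: "m \<ge> 2" and d: "d \<noteq> 0" and p: "0 < p" "p < 1"
  shows "normal_radius m d = p \<longleftrightarrow>
    \<bar>d\<bar> = p ^ (2*m - 1) / (1 - p ^ (2*m)) powr (real (2*m - 1) / real (2*m))"
proof -
  define t where "t = normal_slope m d"
  define r where "r = root (2*m) (1 - p ^ (2*m))"
  have p1: "1 - p ^ (2*m) > 0" using p m by (simp add: power_less_one_iff)
  have r: "r > 0" "r ^ (2*m) = 1 - p ^ (2*m)" using p1 m by (simp_all add: r_def)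
  have G: "(1 - p ^ (2*m)) powr (real (2*m - 1) / real (2*m)) = r ^ (2*m - 1)"
  proof -
    have "(1 - p ^ (2*m)) powr (real (2*m - 1) / real (2*m))
        = ((1 - p ^ (2*m)) powr (1 / real (2*m))) powr (real (2*m - 1))"
      by (simp add: powr_powr)
    also have "\<dots> = r powr (real (2*m - 1))"
      using m p1 by (simp add: r_def root_powr_inverse)
    finally show ?thesis using r by (simp add: powr_realpow)
  qed
  have t0: "\<bar>t\<bar> ^ (2*m - 1) = 1 / \<bar>d\<bar>"
    using normal_slope_power[OF m, of d] by (simp add: t_def power_abs[symmetric])
  have "normal_radius m d = p \<longleftrightarrow> p ^ (2*m) * (1 + t ^ (2*m)) = 1"
    using normal_radius_unique[OF m p(1), of d] normal_radius_power[OF m, of d]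
    by (auto simp: t_def)
  also have "\<dots> \<longleftrightarrow> (p * \<bar>t\<bar>) ^ (2*m) = r ^ (2*m)"
    unfolding r(2) power_mult_distrib distrib_left by (auto simp: power_even_abs)
  also have "\<dots> \<longleftrightarrow> p * \<bar>t\<bar> = r"
    using p r m by (intro power_eq_iff_eq_base) auto
  also have "\<dots> \<longleftrightarrow> (p * \<bar>t\<bar>) ^ (2*m - 1) = r ^ (2*m - 1)"
    using p r m by (intro power_eq_iff_eq_base[symmetric]) auto
  also have "\<dots> \<longleftrightarrow> p ^ (2*m - 1) / \<bar>d\<bar> = r ^ (2*m - 1)"
    by (simp add: power_mult_distrib t0)
  also have "\<dots> \<longleftrightarrow> \<bar>d\<bar> = p ^ (2*m - 1) / r ^ (2*m - 1)"
    using d r by (auto simp: field_simps)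
  finally show ?thesis unfolding G .
qed

text \<open>An odd root is not differentiable at 0, but 1/d avoids this value; the even root is
  taken of a number that is at least 1.\<close>

lemma normal_radius_differentiable:
  assumes "m \<ge> 2" "d \<noteq> 0"
  shows "normal_radius m differentiable (at d)" "normal_slope m differentiable (at d)"
proof -
  have odd: "odd (2*m - 1)" by (rule odd_pred_double) fact
  have "(root (2*m - 1) has_real_derivative inverse (real (2*m - 1) * root (2*m - 1) (1/d) ^ (2*m - 1 - Suc 0))) (at (1/d))"
    using assms odd by (intro DERIV_odd_real_root) auto
  moreover have "((\<lambda>x. 1 / x) has_real_derivative - (1 / d\<^sup>2)) (at d)"
    using assms by (auto intro!: derivative_eq_intros simp: power2_eq_square)
  ultimately have "((\<lambda>x. root (2*m - 1) (1/x)) has_real_derivative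
      (inverse (real (2*m - 1) * root (2*m - 1) (1/d) ^ (2*m - 1 - Suc 0))) * (- (1 / d\<^sup>2))) (at d)"
    by (rule DERIV_chain2)
  then have s: "\<exists>D. (normal_slope m has_real_derivative D) (at d)"
    unfolding normal_slope_def by auto
  then show "normal_slope m differentiable (at d)"
    by (simp add: real_differentiable_def)
  obtain D where D: "(normal_slope m has_real_derivative D) (at d)" using s by blast
  have pos: "1 + normal_slope m d ^ (2*m) > 0" by (simp add: add_pos_nonneg zero_le_even_power)
  have "((\<lambda>x. 1 + normal_slope m x ^ (2*m)) has_real_derivative
      real (2*m) * normal_slope m d ^ (2*m - Suc 0) * D) (at d)"
    by (rule derivative_eq_intros refl D)+ simp
  from DERIV_chain2[OF DERIV_real_root[OF _ pos, of "2*m"] this]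
  have "\<exists>E. ((\<lambda>x. root (2*m) (1 + normal_slope m x ^ (2*m))) has_real_derivative E) (at d)"
    using assms by auto
  then obtain E where "((\<lambda>x. root (2*m) (1 + normal_slope m x ^ (2*m))) has_real_derivative E) (at d)" ..
  from DERIV_divide[OF DERIV_const[of 1] this] show "normal_radius m differentiable (at d)"
    using pos assms unfolding normal_radius_def real_differentiable_def by auto
qed

section \<open>The gradient of \<open>Phi\<close> and the Birkhoff-Gauss map of a rotational
  surface\<close>

lemma Phi_gradient:
  assumes m: "m \<ge> 2"
  shows "GDERIV (Phi m) q :>
    (2 * real m) *\<^sub>R vector [((q$1)\<^sup>2 + (q$2)\<^sup>2) ^ (m - 1) * q$1,
      ((q$1)\<^sup>2 + (q$2)\<^sup>2) ^ (m - 1) * q$2, (q$3) ^ (2*m - 1)]"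
proof -
  have nth: "((\<lambda>x. x$i) has_derivative (\<lambda>h. h$i)) (at q)" for i
    by (rule bounded_linear_imp_has_derivative[OF bounded_linear_vec_nth])
  show ?thesis
    unfolding gderiv_def Phi_def
    by (rule derivative_eq_intros nth refl)+
       (simp add: fun_eq_iff inner_vec_def sum_3 algebra_simps)
qed

lemma GDERIV_unique:
  assumes "GDERIV f x :> D" "GDERIV f x :> E"
  shows "D = E"
proof -
  have "(\<lambda>h. inner h D) = (\<lambda>h. inner h E)"
    using assms unfolding gderiv_def by (rule has_derivative_unique)
  then have "inner (D - E) D = inner (D - E) E" by meson
  then have "inner (D - E) (D - E) = 0" by (simp only: inner_diff_right)
  then show ?thesis by simp
qed

lemma frechet_derivative_GDERIV:
  "GDERIV f x :> D \<Longrightarrow> frechet_derivative f (at x) = (\<lambda>h. inner h D)"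
  unfolding gderiv_def by (rule frechet_derivative_at[symmetric])

text \<open>Identifies the tangent plane of the surface with the orthogonal complement of its
  normal, the form in which the kernel of the differential of \<open>Phi m\<close> appears.\<close>

lemma span_profile_rotation:
  fixes a d v :: real
  assumes "a \<noteq> 0" "d \<noteq> 0"
  defines "x \<equiv> vector [cos v / d, sin v / d, 1] :: real^3"
    and "y \<equiv> vector [- a * sin v, a * cos v, 0] :: real^3"
  shows "span {x, y} = {w. inner w (vector [- cos v, - sin v, 1 / d]) = 0}" (is "_ = ?H")
proof
  have "subspace ?H" 
    by (auto simp: subspace_def inner_add_left)
  moreover have "x \<in> ?H" "y \<in> ?H"
  proof -
    have "cos v * cos v + sin v * sin v = 1"
      using sin_cos_squared_add[of v] by (simp add: power2_eq_square)
    then show "x \<in> ?H" using assms(2)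
      by (simp add: x_def inner_vec_def sum_3 field_simps)
    show "y \<in> ?H" by (simp add: y_def inner_vec_def sum_3 field_simps)
  qed
  ultimately show "span {x, y} \<subseteq> ?H" by (intro span_minimal) auto
  show "?H \<subseteq> span {x, y}"
  proof
    fix w assume "w \<in> ?H"
    then have w: "w$3 / d = w$1 * cos v + w$2 * sin v"
      by (simp add: inner_vec_def sum_3)
    have cs: "cos v * cos v + sin v * sin v = 1"
      using sin_cos_squared_add[of v] by (simp add: power2_eq_square)
    \<comment> \<open>As \<open>y\<close> is horizontal, the third coordinate fixes the coefficient
      of \<open>x\<close>; that of \<open>y\<close> is the component of \<open>w\<close> in the unit
      rotation direction, divided by the radius.\<close>
    have "w = w$3 *\<^sub>R x + ((- sin v * w$1 + cos v * w$2) / a) *\<^sub>R y"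
    proof -
      have "w$1 = (w$3 / d) * cos v - (- sin v * w$1 + cos v * w$2) * sin v"
        using cs unfolding w by algebra
      moreover have "w$2 = (w$3 / d) * sin v + (- sin v * w$1 + cos v * w$2) * cos v"
        using cs unfolding w by algebra
      ultimately show ?thesis using assms(1)
        by (simp add: vec_eq_iff forall_3 x_def y_def)
    qed
    also have "\<dots> \<in> span {x, y}" by (intro span_add span_scale span_base) auto
    finally show "w \<in> span {x, y}" .
  qed
qed

text \<open>The definite description requires two things: the explicit point \<open>N\<close>
  satisfies the conditions, and the gradient equation together with \<open>Phi m q = 1\<close>
  determines the point.\<close>

lemma birkhoff_gauss_rotational:
  assumes m: "m \<ge> 2" and a: "a > 0" and d: "d \<noteq> 0"
    and Xu: "partial_u X h v = vector [cos v / d, sin v / d, 1]"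
    and Xv: "partial_v X h v = vector [- a * sin v, a * cos v, 0]"
  shows "birkhoff_gauss m X h v =
    vector [- normal_radius m d * cos v, - normal_radius m d * sin v, normal_height m d]"
proof -
  define P where "P = normal_radius m d"
  define Q where "Q = normal_height m d"
  define n :: "real^3" where "n = vector [- cos v, - sin v, 1 / d]"
  define N :: "real^3" where "N = vector [- P * cos v, - P * sin v, Q]"
  have P: "P > 0" using normal_radius_pos[OF m] by (simp add: P_def)
  have cs: "cos v * cos v + sin v * sin v = 1"
    using sin_cos_squared_add[of v] by (simp add: power2_eq_square)
  \<comment> \<open>The cross product points towards the axis, whence the minus signs in
    \<open>N\<close>.\<close>
  have cross: "partial_u X h v \<times> partial_v X h v = a *\<^sub>R n"
  proof -
    have "cos v * (a * cos v) + sin v * (a * sin v) = a"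
      using cs by (metis (no_types) distrib_left mult.left_commute mult.right_neutral)
    then show ?thesis
      by (simp add: Xu Xv cross3_def n_def vec_eq_iff forall_3 flip: add_divide_distrib)
  qed
  have N12: "(N$1)\<^sup>2 + (N$2)\<^sup>2 = P\<^sup>2"
    using cs unfolding N_def vector_3 by algebra
  have grad: "GDERIV (Phi m) N :> (2 * real m * P ^ (2*m - 1)) *\<^sub>R n"
  proof -
    have "(2 * real m) *\<^sub>R vector [(P\<^sup>2) ^ (m - 1) * N $ 1, (P\<^sup>2) ^ (m - 1) * N $ 2, N $ 3 ^ (2*m - 1)]
      = (2 * real m * P ^ (2*m - 1)) *\<^sub>R n"
      using normal_height_power[OF m, of d]
      by (simp add: vec_eq_iff forall_3 N_def n_def power_double_pred[OF m] flip: P_def Q_def)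
    then show ?thesis using Phi_gradient[OF m, of N] unfolding N12 by simp
  qed
  have "is_birkhoff_gauss_at m X h v N"
    unfolding is_birkhoff_gauss_at_def
  proof (intro conjI exI)
    show "N \<in> msphere m"
      unfolding msphere_eq[OF m] Phi_def mem_Collect_eq N12
      using normal_on_curve[OF m, of d] by (simp add: N_def power_mult flip: P_def Q_def)
    show "msphere_tangent m N = span {partial_u X h v, partial_v X h v}"
      unfolding msphere_tangent_def frechet_derivative_GDERIV[OF grad] Xu Xv
      using span_profile_rotation[of a d v] a d P m by (simp add: n_def)
    \<comment> \<open>The factor is the quotient of the two multiples of \<open>n\<close>: the
      gradient has 2m P^(2m-1), the cross product has \<open>a\<close>.\<close>
    show "2 * real m * P ^ (2*m - 1) / a > 0" using m P a by simp
    show "GDERIV (Phi m) N :> (2 * real m * P ^ (2*m - 1) / a) *\<^sub>R (partial_u X h v \<times> partial_v X h v)"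
      using grad a by (simp add: cross)
  qed
  moreover have "q = N" if "is_birkhoff_gauss_at m X h v q" for q
  proof -
    define R where "R = (q$1)\<^sup>2 + (q$2)\<^sup>2"
    from that obtain \<phi> where \<phi>: "\<phi> > 0" "GDERIV (Phi m) q :> \<phi> *\<^sub>R (a *\<^sub>R n)" and q: "Phi m q = 1"
      by (auto simp: is_birkhoff_gauss_at_def cross msphere_eq[OF m])
    define l where "l = \<phi> * a / (2 * real m)"
    have l: "l > 0" using \<phi> a m by (simp add: l_def)
    have "(2 * real m) *\<^sub>R vector [R ^ (m - 1) * q$1, R ^ (m - 1) * q$2, (q$3) ^ (2*m - 1)]
        = \<phi> *\<^sub>R (a *\<^sub>R n)"
      unfolding R_def by (rule GDERIV_unique[OF Phi_gradient[OF m] \<phi>(2)])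
    then have eqs: "R ^ (m - 1) * q$1 = - l * cos v" "R ^ (m - 1) * q$2 = - l * sin v"
        "(q$3) ^ (2*m - 1) = l / d"
      using m d by (auto simp: vec_eq_iff forall_3 n_def l_def field_simps)
    \<comment> \<open>\<open>L\<close> plays the role of \<open>P\<close> for the unknown point
      \<open>q\<close>. Its positivity, inherited from \<open>\<phi>\<close>, excludes the antipodal
      point.\<close>
    define L where "L = root (2*m - 1) l"
    have L: "L > 0" "L ^ (2*m - 1) = l" using l m by (simp_all add: L_def)
    \<comment> \<open>Adding the squares of the two horizontal equations eliminates the angle and
      leaves R^(2m-1) = l^2.\<close>
    have "R ^ (2*m - 1) = (R ^ (m - 1))\<^sup>2 * R"
      unfolding power_double_pred[OF m, of R] by (simp add: power_mult[symmetric] mult.commute)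
    also have "\<dots> = (R ^ (m - 1) * q$1)\<^sup>2 + (R ^ (m - 1) * q$2)\<^sup>2"
      by (simp add: R_def power_mult_distrib distrib_left)
    also have "\<dots> = l\<^sup>2 * (cos v * cos v + sin v * sin v)"
      unfolding eqs by algebra
    also have "\<dots> = (L\<^sup>2) ^ (2*m - 1)"
      unfolding cs L(2)[symmetric] by (simp add: power_mult[symmetric] mult.commute)
    finally have R: "R = L\<^sup>2"
      using m by (intro power_eq_imp_eq_base[of R "2*m - 1"]) (auto simp: R_def)
    have l': "l = (L\<^sup>2) ^ (m - 1) * L"
      using L(2) power_double_pred[OF m, of L] by (simp add: mult.commute)
    have q12: "q$1 = - L * cos v" "q$2 = - L * sin v"
    proof -
      have "(L\<^sup>2) ^ (m - 1) * q$1 = (L\<^sup>2) ^ (m - 1) * (- L * cos v)"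
        "(L\<^sup>2) ^ (m - 1) * q$2 = (L\<^sup>2) ^ (m - 1) * (- L * sin v)"
        using eqs(1,2) unfolding R l' by (simp_all only: mult_minus_left mult_minus_right mult.assoc)
      then show "q$1 = - L * cos v" "q$2 = - L * sin v"
        using L(1) unfolding mult_cancel_left by auto
    qed
    have q3: "q$3 = L * normal_slope m d"
    proof -
      have "(q$3) ^ (2*m - 1) = (L * normal_slope m d) ^ (2*m - 1)"
        by (simp add: eqs(3) power_mult_distrib L(2) normal_slope_power[OF m])
      then show ?thesis using odd_pred_double[OF m]
        by (metis odd_real_root_power_cancel)
    qed
    \<comment> \<open>So far \<open>q\<close> is known up to the scale \<open>L\<close>; lying on
      the unit sphere fixes it.\<close>
    have "L ^ (2*m) * (1 + normal_slope m d ^ (2*m)) = 1"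
      using q unfolding Phi_def R_def[symmetric] R q3
      by (simp add: power_mult_distrib power_mult[symmetric] distrib_left)
    then have "L = P" unfolding P_def by (rule normal_radius_unique[OF m L(1)])
    then show ?thesis using q12 q3
      by (simp add: vec_eq_iff forall_3 N_def Q_def normal_height_def P_def)
  qed
  ultimately show ?thesis unfolding birkhoff_gauss_def N_def P_def Q_def by blast
qed

section \<open>The surface parametrized by height and its principal curvatures\<close>

lemma has_vector_derivative_vector_3:
  fixes f g h :: "real \<Rightarrow> real"
  assumes "(f has_real_derivative f') (at x)" "(g has_real_derivative g') (at x)"
    "(h has_real_derivative h') (at x)"
  shows "((\<lambda>s. vector [f s, g s, h s] :: real^3) has_vector_derivative vector [f', g', h']) (at x)"
proof -
  have eq: "vector [a, b, c] = a *\<^sub>R vector [1, 0, 0] + b *\<^sub>R vector [0, 1, 0]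
      + c *\<^sub>R (vector [0, 0, 1] :: real^3)" for a b c :: real
    by (simp add: vec_eq_iff forall_3)
  show ?thesis
    unfolding eq[of "f _"] eq[of f']
    by (auto intro!: derivative_eq_intros assms simp: assms)
qed

text \<open>The first derivative of \<open>u\<close> enters the Birkhoff-Gauss map, the second its
  differential.\<close>

locale rotational_profile =
  fixes I :: "real set" and u :: "real \<Rightarrow> real"
  assumes open_I: "open I" and interval_I: "is_interval I" and pos_I: "I \<subseteq> {0<..}"
    and differentiable_u: "x \<in> I \<Longrightarrow> u differentiable (at x)"
    and differentiable_deriv_u: "x \<in> I \<Longrightarrow> deriv u differentiable (at x)"
    and deriv_u_nonzero: "x \<in> I \<Longrightarrow> deriv u x \<noteq> 0"
begin

abbreviation "X \<equiv> rot_surface_by_height I u"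

lemma DERIV_u: "x \<in> I \<Longrightarrow> (u has_real_derivative deriv u x) (at x)"
  by (simp add: DERIV_deriv_iff_real_differentiable differentiable_u)

lemma continuous_on_u: "continuous_on I u"
  using DERIV_u DERIV_isCont continuous_at_imp_continuous_on by blast

lemma inj_on_u: "inj_on u I"
proof (rule linorder_inj_onI)
  fix x y assume xy: "x < y" "x \<in> I" "y \<in> I"
  then have sub: "{x..y} \<subseteq> I"
    using interval_I by (meson atLeastAtMost_iff mem_is_interval_1_I subsetI)
  show "u x \<noteq> u y"
  proof
    assume "u x = u y"
    then obtain z where "x < z" "z < y" "(u has_real_derivative 0) (at z)"
      using Rolle[of x y u] xy sub continuous_on_subset[OF continuous_on_u sub] differentiable_u
      by (meson atLeastAtMost_iff less_imp_le subsetD)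
    moreover from this have "z \<in> I" using sub by auto
    ultimately show False
      using deriv_u_nonzero[of z] DERIV_imp_deriv[of u 0 z] by auto
  qed
qed auto

lemma DERIV_inverse_u:
  assumes "x \<in> I"
  shows "(inv_into I u has_real_derivative 1 / deriv u x) (at (u x))"
  unfolding has_field_derivative_def
proof (rule has_derivative_inverse_strong[OF open_I assms continuous_on_u])
  show "(u has_derivative (*) (deriv u x)) (at x)"
    using DERIV_u[OF assms] by (simp add: has_field_derivative_def)
qed (use deriv_u_nonzero[OF assms] inj_on_u in \<open>auto simp: fun_eq_iff\<close>)

text \<open>Passing from radius to height multiplies derivatives by 1/u'. The factor affects the
  surface and its Birkhoff-Gauss map alike, so it cancels in \<open>k1\<close>.\<close>

lemma has_vector_derivative_by_height:
  fixes g :: "real \<Rightarrow> 'a::real_normed_vector"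
  assumes "x \<in> I" "(g has_vector_derivative g') (at x)"
  shows "((\<lambda>s. g (inv_into I u s)) has_vector_derivative (1 / deriv u x) *\<^sub>R g') (at (u x))"
  using vector_diff_chain_at[of "inv_into I u" "1 / deriv u x" "u x" g g'] assms DERIV_inverse_u[of x]
  by (simp add: has_real_derivative_iff_has_vector_derivative inj_on_u o_def)

lemma partial_u_X:
  assumes "x \<in> I"
  shows "partial_u X (u x) v = vector [cos v / deriv u x, sin v / deriv u x, 1]"
proof -
  have "((\<lambda>a. rot_surface u a v) has_vector_derivative vector [cos v, sin v, deriv u x]) (at x)"
    unfolding rot_surface_def using assms
    by (intro has_vector_derivative_vector_3) (auto intro!: derivative_eq_intros DERIV_u)
  from has_vector_derivative_by_height[OF assms this]
  have "partial_u X (u x) v = (1 / deriv u x) *\<^sub>R vector [cos v, sin v, deriv u x]"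
    unfolding partial_u_def rot_surface_by_height_def by (rule vector_derivative_at)
  then show ?thesis
    using deriv_u_nonzero[OF assms] by (simp add: vec_eq_iff forall_3)
qed

lemma partial_v_X:
  assumes "x \<in> I"
  shows "partial_v X (u x) v = vector [- x * sin v, x * cos v, 0]"
proof -
  have "((\<lambda>t. vector [x * cos t, x * sin t, u x] :: real^3) has_vector_derivative
      vector [- x * sin v, x * cos v, 0]) (at v)"
    by (intro has_vector_derivative_vector_3) (auto intro!: derivative_eq_intros)
  then show ?thesis
    unfolding partial_v_def rot_surface_by_height_def rot_surface_def inv_into_f_f[OF inj_on_u assms]
    by (rule vector_derivative_at)
qed

lemma birkhoff_gauss_X:
  assumes "m \<ge> 2" "x \<in> I"
  shows "birkhoff_gauss m X (u x) v =
    vector [- normal_radius m (deriv u x) * cos v, - normal_radius m (deriv u x) * sin v,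
      normal_height m (deriv u x)]"
  using assms pos_I partial_u_X partial_v_X deriv_u_nonzero
  by (intro birkhoff_gauss_rotational[of m x]) auto

text \<open>Rotation moves only the horizontal parts of the surface point and of its Birkhoff-Gauss
  image, and these are proportional with the constant factor -P/x.\<close>

lemma k2_X:
  assumes "m \<ge> 2" "x \<in> I"
  shows "k2 m X (u x) v = - normal_radius m (deriv u x) / x"
proof -
  define P where "P = normal_radius m (deriv u x)"
  define Y :: "real^3" where "Y = vector [- x * sin v, x * cos v, 0]"
  have x: "x > 0" using assms pos_I by auto
  have "((\<lambda>t. birkhoff_gauss m X (u x) t) has_vector_derivative vector [P * sin v, - P * cos v, 0]) (at v)"
    unfolding birkhoff_gauss_X[OF assms] P_def
    by (intro has_vector_derivative_vector_3) (auto intro!: derivative_eq_intros)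
  moreover have "vector [P * sin v, - P * cos v, 0] = (- P / x) *\<^sub>R Y"
    using x by (simp add: Y_def vec_eq_iff forall_3)
  ultimately have *: "((\<lambda>t. birkhoff_gauss m X (u x) t) has_vector_derivative (- P / x) *\<^sub>R Y) (at v)"
    by simp
  \<comment> \<open>A nonzero tangent vector makes the eigenvalue unique, as the definite
    description demands.\<close>
  have Y: "Y \<noteq> 0"
    using x sin_zero_abs_cos_one[of v] by (auto simp: Y_def vec_eq_iff forall_3)
  show ?thesis
    unfolding k2_def partial_v_X[OF assms(2)] Y_def[symmetric] P_def[symmetric]
    using * Y by (intro the_equality) (auto dest: vector_derivative_unique_at simp del: scaleR_minus_left)
qed

lemma differentiable_normal:
  assumes "m \<ge> 2" "x \<in> I"
  shows "(\<lambda>y. normal_radius m (deriv u y)) differentiable (at x)"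
    and "(\<lambda>y. normal_height m (deriv u y)) differentiable (at x)"
proof -
  show rad: "(\<lambda>y. normal_radius m (deriv u y)) differentiable (at x)"
    using differentiable_chain_at[of "deriv u" x "normal_radius m"] differentiable_deriv_u[OF assms(2)]
      normal_radius_differentiable(1)[OF assms(1) deriv_u_nonzero[OF assms(2)]] by (simp add: o_def)
  have "(\<lambda>y. normal_slope m (deriv u y)) differentiable (at x)"
    using differentiable_chain_at[of "deriv u" x "normal_slope m"] differentiable_deriv_u[OF assms(2)]
      normal_radius_differentiable(2)[OF assms(1) deriv_u_nonzero[OF assms(2)]] by (simp add: o_def)
  then show "(\<lambda>y. normal_height m (deriv u y)) differentiable (at x)"
    unfolding normal_height_def using rad by (rule differentiable_mult)
qed

text \<open>The velocity (-p, q) of the meridian of the Birkhoff-Gauss map is tangent to the unit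
  curve, hence parallel to the profile direction (1, d); comparing first components gives the
  eigenvalue.\<close>

lemma k1_X:
  assumes m: "m \<ge> 2" and x: "x \<in> I"
    and p: "((\<lambda>y. normal_radius m (deriv u y)) has_real_derivative p) (at x)"
  shows "k1 m X (u x) v = - p"
proof -
  define d where "d = deriv u x"
  define P where "P = normal_radius m d"
  define Q where "Q = normal_height m d"
  define Y :: "real^3" where "Y = vector [cos v / d, sin v / d, 1]"
  have d: "d \<noteq> 0" using deriv_u_nonzero x by (simp add: d_def)
  obtain q where q: "((\<lambda>y. normal_height m (deriv u y)) has_real_derivative q) (at x)"
    using differentiable_normal(2)[OF m x] unfolding real_differentiable_def by blast
  \<comment> \<open>Differentiating P^(2m) + Q^(2m) = 1 and dividing by P^(2m-1) leaves p + q/d =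
    0.\<close>
  have qp: "q = - p * d"
  proof -
    have "((\<lambda>y. normal_radius m (deriv u y) ^ (2*m) + normal_height m (deriv u y) ^ (2*m))
        has_real_derivative real (2*m) * (p * P ^ (2*m - Suc 0)) + real (2*m) * (q * Q ^ (2*m - Suc 0))) (at x)"
      by (rule derivative_eq_intros p q refl)+ (simp add: P_def Q_def d_def)
    then have "((\<lambda>y. 1) has_real_derivative 2 * real m * (p * P ^ (2*m - 1) + q * Q ^ (2*m - 1))) (at x)"
      unfolding normal_on_curve[OF m] by (simp add: One_nat_def algebra_simps)
    then have "2 * real m * (p * P ^ (2*m - 1) + q * Q ^ (2*m - 1)) = 0"
      using DERIV_const DERIV_unique by blast
    then have "p * P ^ (2*m - 1) + q * Q ^ (2*m - 1) = 0" using m by simp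
    then have "P ^ (2*m - 1) * (p + q / d) = 0"
      using normal_height_power[OF m, of d] by (simp add: algebra_simps flip: P_def Q_def)
    then have "p + q / d = 0" using normal_radius_pos[OF m, of d] by (simp add: P_def)
    then show ?thesis using d by (simp add: field_simps)
  qed
  define N where "N y = (vector [- normal_radius m (deriv u y) * cos v,
      - normal_radius m (deriv u y) * sin v, normal_height m (deriv u y)] :: real^3)" for y
  have "(N has_vector_derivative vector [- p * cos v, - p * sin v, q]) (at x)"
    unfolding N_def
    by (intro has_vector_derivative_vector_3) (auto intro!: derivative_eq_intros p q)
  from has_vector_derivative_by_height[OF x this]
  moreover have "(1 / d) *\<^sub>R vector [- p * cos v, - p * sin v, q] = - p *\<^sub>R Y"
    using d by (simp add: qp Y_def vec_eq_iff forall_3)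
  ultimately have "((\<lambda>s. N (inv_into I u s)) has_vector_derivative - p *\<^sub>R Y) (at (u x))"
    by (simp only: d_def)
  then have *: "((\<lambda>s. birkhoff_gauss m X s v) has_vector_derivative - p *\<^sub>R Y) (at (u x))"
  proof (rule has_vector_derivative_transform_within_open)
    \<comment> \<open>The explicit formula is available only at heights attained by
      \<open>u\<close>, so these must form a neighbourhood of \<open>u x\<close>.\<close>
    show "open (u ` I)" by (intro invariance_of_domain continuous_on_u open_I inj_on_u)
    show "u x \<in> u ` I" using x by simp
    show "N (inv_into I u s) = birkhoff_gauss m X s v" if "s \<in> u ` I" for s
      using that birkhoff_gauss_X[OF m] by (auto simp: inj_on_u N_def)
  qed
  have Y: "Y \<noteq> 0" by (simp add: Y_def vec_eq_iff forall_3)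
  show ?thesis
    unfolding k1_def partial_u_X[OF x] d_def[symmetric] Y_def[symmetric]
    using * Y by (intro the_equality) (auto dest: vector_derivative_unique_at simp del: scaleR_minus_left)
qed

section \<open>The linear differential equation for the radius P, and the sign of the slope\<close>

lemma curvature_difference_iff:
  assumes m: "m \<ge> 2"
  shows "(\<forall>x\<in>I. \<forall>v. k1 m X (u x) v - k2 m X (u x) v = \<mu>) \<longleftrightarrow>
    (\<exists>c. \<forall>x\<in>I. normal_radius m (deriv u x) = x * (c - \<mu> * ln x))"
proof -
  define P where "P x = normal_radius m (deriv u x)" for x
  define P' where "P' = deriv P"
  have P: "(P has_real_derivative P' x) (at x)" if "x \<in> I" for x
    using differentiable_normal(1)[OF m that]
    by (simp add: P'_def DERIV_deriv_iff_real_differentiable flip: P_def)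
  have k: "k1 m X (u x) v - k2 m X (u x) v = P x / x - P' x" if "x \<in> I" for x v
    using k1_X[OF m that] k2_X[OF m that] P[OF that] by (simp add: P_def[abs_def])
  have pos: "x > 0" if "x \<in> I" for x using that pos_I by auto
  have "(\<forall>x\<in>I. P x / x - P' x = \<mu>) \<longleftrightarrow> (\<exists>c. \<forall>x\<in>I. P x = x * (c - \<mu> * ln x))"
  proof
    assume L: "\<forall>x\<in>I. P x / x - P' x = \<mu>"
    \<comment> \<open>A first integral: (P/x)' = -(P/x - P')/x = -\<mu>/x. Its constant value on the
      interval is \<open>c\<close>.\<close>
    have "((\<lambda>x. P x / x + \<mu> * ln x) has_real_derivative 0) (at x within I)" if "x \<in> I" for x
    proof -
      have "((\<lambda>x. P x / x + \<mu> * ln x) has_real_derivative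
          (P' x * x - P x * 1) / (x * x) + \<mu> * (1 / x)) (at x)"
        using pos[OF that] by (auto intro!: derivative_eq_intros P[OF that])
      moreover have "(P' x * x - P x * 1) / (x * x) + \<mu> * (1 / x) = 0"
        using L[rule_format, OF that] pos[OF that] by (auto simp: field_simps)
      ultimately show ?thesis by (simp add: has_field_derivative_at_within)
    qed
    then obtain c where "\<forall>x\<in>I. P x / x + \<mu> * ln x = c"
      using has_field_derivative_zero_constant[of I] interval_I is_interval_convex by blast
    then have "P x = x * (c - \<mu> * ln x)" if "x \<in> I" for x
      using pos[OF that] that by (auto simp: field_simps)
    then show "\<exists>c. \<forall>x\<in>I. P x = x * (c - \<mu> * ln x)" by blast
  next
    assume "\<exists>c. \<forall>x\<in>I. P x = x * (c - \<mu> * ln x)"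
    then obtain c where c: "\<And>x. x \<in> I \<Longrightarrow> P x = x * (c - \<mu> * ln x)" by blast
    show "\<forall>x\<in>I. P x / x - P' x = \<mu>"
    proof
      fix x assume x: "x \<in> I"
      have "((\<lambda>x. x * (c - \<mu> * ln x)) has_real_derivative c - \<mu> * ln x - \<mu>) (at x)"
        using pos[OF x] by (auto intro!: derivative_eq_intros)
      then have "(P has_real_derivative c - \<mu> * ln x - \<mu>) (at x)"
        by (rule has_field_derivative_transform_within_open[OF _ open_I x]) (simp add: c)
      then have "P' x = c - \<mu> * ln x - \<mu>" using P[OF x] DERIV_unique by blast
      then show "P x / x - P' x = \<mu>" using c[OF x] pos[OF x] by simp
    qed
  qed
  then show ?thesis unfolding P_def[symmetric] using k by simp
qed

lemma deriv_u_sign: "\<exists>\<sigma>\<in>{1, -1}. \<forall>x\<in>I. deriv u x = \<sigma> * \<bar>deriv u x\<bar>"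
proof -
  have "continuous_on I (deriv u)"
    using differentiable_deriv_u by (meson continuous_at_imp_continuous_on differentiable_imp_continuous_within)
  then have conn: "connected (deriv u ` I)"
    using interval_I is_interval_connected connected_continuous_image by blast
  have "(\<forall>x\<in>I. deriv u x > 0) \<or> (\<forall>x\<in>I. deriv u x < 0)"
  proof (rule ccontr)
    assume "\<not> ?thesis"
    then obtain x y where "x \<in> I" "y \<in> I" "deriv u x \<le> 0" "deriv u y \<ge> 0"
      by (meson not_less)
    then have "0 \<in> deriv u ` I"
      using connectedD_interval[OF conn, of "deriv u x" "deriv u y" 0] by blast
    then show False using deriv_u_nonzero by force
  qed
  then show ?thesis by force
qed

end

section \<open>From the radius P back to the profile function\<close>

theorem theorem6p1:
  fixes m :: nat and \<mu> :: real and I :: "real set" and u :: "real \<Rightarrow> real"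
  assumes "m \<ge> 2" and "\<mu> \<noteq> 0"
    and "open I" and "is_interval I" and "I \<subseteq> {0<..}"
    and "smooth_on_open I u"
    and "\<forall>\<alpha>\<in>I. deriv u \<alpha> \<noteq> 0"
  shows "(\<forall>\<alpha>\<in>I. \<forall>v.
            k1 m (rot_surface_by_height I u) (u \<alpha>) v
              - k2 m (rot_surface_by_height I u) (u \<alpha>) v = \<mu>)
         \<longleftrightarrow>
         (\<exists>c\<^sub>1. (\<forall>\<alpha>\<in>I. c\<^sub>1 - \<mu> * ln \<alpha> > 0 \<and> \<alpha> * (c\<^sub>1 - \<mu> * ln \<alpha>) < 1) \<and>
            (\<exists>\<sigma>\<in>{1, -1}. \<forall>\<alpha>\<in>I.
               (u has_real_derivative \<sigma> * profile_integrand m \<mu> c\<^sub>1 \<alpha>) (at \<alpha>)))"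
proof -
  note m = \<open>m \<ge> 2\<close>
  interpret rotational_profile I u
  proof
    show "u differentiable (at x)" "deriv u differentiable (at x)" if "x \<in> I" for x
      using \<open>smooth_on_open I u\<close> that unfolding smooth_on_open_def
      by (auto dest: spec[of _ 0] spec[of _ "Suc 0"])
  qed (use assms in auto)
  have pos: "x > 0" if "x \<in> I" for x using that pos_I by auto
  \<comment> \<open>With p = x (c - \<mu> ln x), the formula recovering |d| from the radius is
    exactly the integrand.\<close>
  have iff: "normal_radius m (deriv u x) = x * (c - \<mu> * ln x) \<longleftrightarrow>
      \<bar>deriv u x\<bar> = profile_integrand m \<mu> c x"
    if "x \<in> I" "c - \<mu> * ln x > 0" "x * (c - \<mu> * ln x) < 1" for x c
    using normal_radius_eq_iff[OF m deriv_u_nonzero[OF that(1)], of "x * (c - \<mu> * ln x)"] that pos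
    by (simp add: profile_integrand_def power_mult_distrib)
  \<comment> \<open>These inequalities restate 0 < P < 1 for the solution of the differential
    equation.\<close>
  have bounds: "c - \<mu> * ln x > 0 \<and> x * (c - \<mu> * ln x) < 1"
    if "x \<in> I" "normal_radius m (deriv u x) = x * (c - \<mu> * ln x)" for x c
    using normal_radius_pos[OF m, of "deriv u x"] normal_radius_less_1[OF m deriv_u_nonzero[OF that(1)]]
      that pos[OF that(1)] by (simp add: zero_less_mult_iff)
  show ?thesis
    unfolding curvature_difference_iff[OF m]
  proof (intro iffI; elim exE conjE bexE)
    fix c assume c: "\<forall>x\<in>I. normal_radius m (deriv u x) = x * (c - \<mu> * ln x)"
    obtain \<sigma> where \<sigma>: "\<sigma> \<in> {1, -1}" "\<And>x. x \<in> I \<Longrightarrow> deriv u x = \<sigma> * \<bar>deriv u x\<bar>"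
      using deriv_u_sign by blast
    have "(u has_real_derivative \<sigma> * profile_integrand m \<mu> c x) (at x)" if "x \<in> I" for x
      using DERIV_u[OF that] \<sigma>(2)[OF that] iff[OF that] bounds[OF that] c that by metis
    then show "\<exists>c\<^sub>1. (\<forall>\<alpha>\<in>I. c\<^sub>1 - \<mu> * ln \<alpha> > 0 \<and> \<alpha> * (c\<^sub>1 - \<mu> * ln \<alpha>) < 1) \<and>
        (\<exists>\<sigma>\<in>{1, -1}. \<forall>\<alpha>\<in>I. (u has_real_derivative \<sigma> * profile_integrand m \<mu> c\<^sub>1 \<alpha>) (at \<alpha>))"
      using c bounds \<sigma>(1) by blast
  next
    fix c \<sigma> assume b: "\<forall>x\<in>I. c - \<mu> * ln x > 0 \<and> x * (c - \<mu> * ln x) < 1" and \<sigma>: "\<sigma> \<in> {1, - 1 :: real}"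
      and D: "\<forall>x\<in>I. (u has_real_derivative \<sigma> * profile_integrand m \<mu> c x) (at x)"
    have "normal_radius m (deriv u x) = x * (c - \<mu> * ln x)" if x: "x \<in> I" for x
    proof -
      \<comment> \<open>Nonnegativity lets the absolute value strip off the sign
        \<open>\<sigma>\<close> without changing the integrand.\<close>
      have "profile_integrand m \<mu> c x \<ge> 0"
        unfolding profile_integrand_def using b x pos[OF x]
        by (intro divide_nonneg_nonneg mult_nonneg_nonneg zero_le_power powr_ge_zero) (auto simp: less_imp_le)
      moreover have "deriv u x = \<sigma> * profile_integrand m \<mu> c x"
        using D x DERIV_imp_deriv by blast
      ultimately have "\<bar>deriv u x\<bar> = profile_integrand m \<mu> c x"
        using \<sigma> by (auto simp: abs_mult)
      then show ?thesis using iff b x by blast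
    qed
    then show "\<exists>c. \<forall>x\<in>I. normal_radius m (deriv u x) = x * (c - \<mu> * ln x)" by blast
  qed
qed

end
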